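(* If $p = 1/n$ or $p = (n-1)/n$, then the parity function is the only locally $p$-stable function on the hypercube $\{-1,1\}^n$, up to isomorphisms. (Here the parity function meant is, for $p=(n-1)/n$, the parity function on one variable, $x\mapsto x_n$, and, for $p=1/n$, the parity function on $n-1$ variables, $x\mapsto x_2x_3\cdots x_n$.)
   Context: Here $n$ is a natural number, and the hypercube $\{-1,1\}^n$ is regarded as a graph in which two vertices are adjacent iff they differ in exactly one coordinate. A function $f:\{-1,1\}^n\to\{-1,1\}$ is called locally $p$-stable if for every vertex $x$, $|\{y\sim x : f(y)=f(x)\}|/n = p$. Two functions $f,g:\{-1,1\}^n\to\{-1,1\}$ are isomorphic if there is a graph automorphism $\psi$ of the hypercube with $f\circ\psi=g$. The parity function on a set of variables is the product of those variables.
   Formalization: The case p = 1/n is stated for n ≥ 2 only: for n = 1 it reads p = 1, and the constants 1 and −1 are both locally 1-stable on {−1,1} but not isomorphic, so the claim fails there; the case p = (n−1)/n is stated for all n ≥ 1. *)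

theory Defs
  imports Complex_Main "HOL-Library.FuncSet"
begin

text \<open>
  Coordinates are numbered from 1 to \<open>n\<close>. Vertices are extensional functions on \<open>{1..n}\<close>, so
  the carrier has exactly \<open>2 ^ n\<close> elements and HOL equality of vertices is equality of points.
\<close>

definition hypercube :: "nat \<Rightarrow> (nat \<Rightarrow> int) set" where
  "hypercube n = {1..n} \<rightarrow>\<^sub>E {-1, 1}"

definition adjacent :: "nat \<Rightarrow> (nat \<Rightarrow> int) \<Rightarrow> (nat \<Rightarrow> int) \<Rightarrow> bool" where
  "adjacent n x y \<longleftrightarrow> x \<in> hypercube n \<and> y \<in> hypercube n \<and> card {i \<in> {1..n}. x i \<noteq> y i} = 1"

text \<open>
  Functions on the hypercube are HOL functions whose values outside the carrier are irrelevant.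
  For \<open>n = 0\<close> the quotient below is not meaningful.
\<close>

definition locally_stable :: "nat \<Rightarrow> real \<Rightarrow> ((nat \<Rightarrow> int) \<Rightarrow> int) \<Rightarrow> bool" where
  "locally_stable n p f \<longleftrightarrow>
     f \<in> hypercube n \<rightarrow> {-1, 1} \<and>
     (\<forall>x \<in> hypercube n. real (card {y. adjacent n x y \<and> f y = f x}) / real n = p)"

definition hypercube_automorphism :: "nat \<Rightarrow> ((nat \<Rightarrow> int) \<Rightarrow> (nat \<Rightarrow> int)) \<Rightarrow> bool" where
  "hypercube_automorphism n \<psi> \<longleftrightarrow>
     bij_betw \<psi> (hypercube n) (hypercube n) \<and>
     (\<forall>x \<in> hypercube n. \<forall>y \<in> hypercube n. adjacent n (\<psi> x) (\<psi> y) \<longleftrightarrow> adjacent n x y)"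

definition isomorphic ::
  "nat \<Rightarrow> ((nat \<Rightarrow> int) \<Rightarrow> int) \<Rightarrow> ((nat \<Rightarrow> int) \<Rightarrow> int) \<Rightarrow> bool" where
  "isomorphic n f g \<longleftrightarrow>
     (\<exists>\<psi>. hypercube_automorphism n \<psi> \<and> (\<forall>x \<in> hypercube n. f (\<psi> x) = g x))"

definition parity_function :: "nat set \<Rightarrow> (nat \<Rightarrow> int) \<Rightarrow> int" where
  "parity_function S x = (\<Prod>i\<in>S. x i)"

definition unique_locally_stable :: "nat \<Rightarrow> real \<Rightarrow> ((nat \<Rightarrow> int) \<Rightarrow> int) \<Rightarrow> bool" where
  "unique_locally_stable n p g \<longleftrightarrow>
     locally_stable n p g \<and> (\<forall>f. locally_stable n p f \<longrightarrow> isomorphic n f g)"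

end

theory Submission
  imports Defs
begin

text \<open>
  Let every vertex \<open>x\<close> have exactly one neighbour on which \<open>f\<close> takes the other value, and let
  \<open>i\<close> be the direction towards it. For another direction \<open>j\<close>, look at the square spanned by \<open>i\<close>
  and \<open>j\<close> at \<open>x\<close>: \<open>f\<close> agrees on \<open>x\<close> and its \<open>j\<close>-neighbour, and since the \<open>i\<close>-neighbour of \<open>x\<close>
  already spends its only disagreement on \<open>x\<close>, \<open>f\<close> also agrees along the opposite side. So the
  \<open>j\<close>-neighbour of \<open>x\<close> has its disagreement in direction \<open>i\<close> as well. As the cube is connected,
  one direction \<open>i\<close> serves all vertices, and \<open>f x = c * x i\<close> for a constant sign \<open>c\<close>
  (\<open>one_disagreeing_neighbour_imp_signed_coordinate\<close>). This settles the case \<open>p = (n - 1) / n\<close>.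

  Multiplying \<open>f\<close> by the product of all variables exchanges agreement and disagreement along every
  edge. A function with exactly one agreeing neighbour at every vertex therefore has the form
  \<open>c * x i * (\<Prod>j=1..n. x j)\<close>, which is \<open>c\<close> times the parity on \<open>{1..n} - {i}\<close>. This settles the
  case \<open>p = 1 / n\<close>.

  What remains is to normalise a signed parity \<open>c * (\<Prod>j\<in>S. x j)\<close>: a permutation of the
  coordinates moves \<open>S\<close> to any set of the same size, and reflecting one coordinate of \<open>S\<close> absorbs
  the sign (\<open>signed_parity_isomorphic\<close>).
\<close>

section \<open>Flipping coordinates\<close>

definition flip :: "nat \<Rightarrow> (nat \<Rightarrow> int) \<Rightarrow> (nat \<Rightarrow> int)" where
  "flip i x = x(i := - x i)"

lemma flip_flip [simp]: "flip i (flip i x) = x"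
  by (auto simp: flip_def)

lemma flip_commute: "flip i (flip j x) = flip j (flip i x)"
  by (auto simp: flip_def)

lemma hypercube_coord: "x \<in> hypercube n \<Longrightarrow> i \<in> {1..n} \<Longrightarrow> x i = -1 \<or> x i = 1"
  unfolding hypercube_def by (drule PiE_mem) auto

lemma hypercube_coord_square: "x \<in> hypercube n \<Longrightarrow> i \<in> {1..n} \<Longrightarrow> x i * x i = 1"
  by (drule (1) hypercube_coord) auto

lemma flip_in_hypercube: "x \<in> hypercube n \<Longrightarrow> i \<in> {1..n} \<Longrightarrow> flip i x \<in> hypercube n"
  using hypercube_coord[of x n i]
  by (auto simp: hypercube_def flip_def PiE_iff extensional_def)

lemma hypercube_eqI:
  "x \<in> hypercube n \<Longrightarrow> y \<in> hypercube n \<Longrightarrow> (\<And>i. i \<in> {1..n} \<Longrightarrow> x i = y i) \<Longrightarrow> x = y"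
  unfolding hypercube_def by (rule PiE_ext)

lemma finite_hypercube: "finite (hypercube n)"
  unfolding hypercube_def by (intro finite_PiE) auto

lemma hypercube_nonempty: "hypercube n \<noteq> {}"
  unfolding hypercube_def by (simp add: PiE_eq_empty_iff)

lemma flip_neq:
  assumes "x \<in> hypercube n" "i \<in> {1..n}"
  shows "flip i x i \<noteq> x i"
  using hypercube_coord[OF assms] by (auto simp: flip_def)

lemma adjacent_iff_flip:
  assumes "x \<in> hypercube n"
  shows "adjacent n x y \<longleftrightarrow> (\<exists>i\<in>{1..n}. y = flip i x)"
proof
  assume "adjacent n x y"
  then have y: "y \<in> hypercube n" and "card {i \<in> {1..n}. x i \<noteq> y i} = 1"
    by (auto simp: adjacent_def)
  then obtain i where i: "{i \<in> {1..n}. x i \<noteq> y i} = {i}"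
    using card_1_singletonE by blast
  then have iN: "i \<in> {1..n}" and "x i \<noteq> y i"
    by auto
  then have "y i = - x i"
    using hypercube_coord[OF assms iN] hypercube_coord[OF y iN] by auto
  moreover have "y j = x j" if "j \<in> {1..n}" "j \<noteq> i" for j
  proof (rule ccontr)
    assume "y j \<noteq> x j"
    then have "j \<in> {i \<in> {1..n}. x i \<noteq> y i}" using that(1) by simp
    then show False using that(2) unfolding i by simp
  qed
  ultimately have "y = flip i x"
    by (intro hypercube_eqI[OF y flip_in_hypercube[OF assms iN]]) (auto simp: flip_def)
  with iN show "\<exists>i\<in>{1..n}. y = flip i x" by blast
next
  assume "\<exists>i\<in>{1..n}. y = flip i x"
  then obtain i where i: "i \<in> {1..n}" and y: "y = flip i x" by blast
  have "{j \<in> {1..n}. x j \<noteq> y j} = {i}"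
    using i flip_neq[OF assms i] unfolding y by (auto simp: flip_def)
  then show "adjacent n x y"
    using assms flip_in_hypercube[OF assms i] by (simp add: adjacent_def y)
qed

lemma card_agreeing_neighbours:
  assumes x: "x \<in> hypercube n"
  shows "card {y. adjacent n x y \<and> f y = f x} = card {i \<in> {1..n}. f (flip i x) = f x}"
proof -
  have "inj_on (\<lambda>i. flip i x) {1..n}"
  proof (rule inj_onI)
    fix i j assume i: "i \<in> {1..n}" and eq: "flip i x = flip j x"
    show "i = j"
      using flip_neq[OF x i] unfolding eq by (auto simp: flip_def split: if_splits)
  qed
  then have "inj_on (\<lambda>i. flip i x) {i \<in> {1..n}. f (flip i x) = f x}"
    by (rule inj_on_subset) auto
  moreover have "{y. adjacent n x y \<and> f y = f x}
      = (\<lambda>i. flip i x) ` {i \<in> {1..n}. f (flip i x) = f x}"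
    by (auto simp: adjacent_iff_flip[OF x])
  ultimately show ?thesis
    by (simp add: card_image)
qed

text \<open>
  Connectedness of the cube, in the form in which it is used: induction on the number of
  coordinates in which two vertices differ.
\<close>
lemma flip_invariant_imp_constant:
  assumes inv: "\<And>x i. x \<in> hypercube n \<Longrightarrow> i \<in> {1..n} \<Longrightarrow> h (flip i x) = h x"
    and "x \<in> hypercube n" "y \<in> hypercube n"
  shows "h x = h y"
  using assms(2)
proof (induction "card {i \<in> {1..n}. x i \<noteq> y i}" arbitrary: x rule: less_induct)
  case less
  show ?case
  proof (cases "x = y")
    case False
    then have "\<not> (\<forall>i\<in>{1..n}. x i = y i)"
      using hypercube_eqI[OF less.prems assms(3)] by metis
    then obtain i where i: "i \<in> {1..n}" "x i \<noteq> y i"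
      by blast
    have "flip i x i = y i"
      using i hypercube_coord[OF less.prems i(1)] hypercube_coord[OF assms(3) i(1)]
      by (auto simp: flip_def)
    then have "{j \<in> {1..n}. flip i x j \<noteq> y j} \<subset> {j \<in> {1..n}. x j \<noteq> y j}"
      using i by (auto simp: flip_def)
    then have "card {j \<in> {1..n}. flip i x j \<noteq> y j} < card {j \<in> {1..n}. x j \<noteq> y j}"
      by (intro psubset_card_mono) auto
    then have "h (flip i x) = h y"
      using less.hyps flip_in_hypercube[OF less.prems i(1)] by blast
    with inv[OF less.prems i(1)] show ?thesis by simp
  qed simp
qed

section \<open>Parity functions\<close>

lemma parity_function_flip:
  assumes "finite S"
  shows "parity_function S (flip i x)
    = (if i \<in> S then - parity_function S x else parity_function S x)"
proof (cases "i \<in> S")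
  case True
  have "(\<Prod>j\<in>S - {i}. flip i x j) = (\<Prod>j\<in>S - {i}. x j)"
    by (rule prod.cong) (auto simp: flip_def)
  then show ?thesis
    using True assms
    by (simp add: parity_function_def prod.remove[of S i] flip_def)
next
  case False
  then have "(\<Prod>j\<in>S. flip i x j) = (\<Prod>j\<in>S. x j)"
    by (intro prod.cong) (auto simp: flip_def)
  with False show ?thesis by (simp add: parity_function_def)
qed

lemma parity_function_values:
  assumes x: "x \<in> hypercube n" and "S \<subseteq> {1..n}"
  shows "parity_function S x \<in> {-1, 1}"
proof -
  have "finite S" using assms(2) finite_subset by blast
  then show ?thesis
    using assms(2)
  proof (induction S)
    case (insert i S)
    then show ?case
      using hypercube_coord[OF x, of i] by (auto simp: parity_function_def)
  qed (simp add: parity_function_def)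
qed

text \<open>
  The parity on \<open>S\<close> changes exactly along the edges whose direction lies in \<open>S\<close>.
\<close>
lemma locally_stable_parity:
  assumes "S \<subseteq> {1..n}"
  shows "locally_stable n (real (n - card S) / real n) (parity_function S)"
  unfolding locally_stable_def
proof (intro conjI ballI funcsetI)
  fix x assume x: "x \<in> hypercube n"
  show "parity_function S x \<in> {-1, 1}"
    by (rule parity_function_values[OF x assms])
next
  fix x assume x: "x \<in> hypercube n"
  have "finite S" using assms finite_subset by blast
  then have "{i \<in> {1..n}. parity_function S (flip i x) = parity_function S x} = {1..n} - S"
    using parity_function_values[OF x assms] by (auto simp: parity_function_flip)
  then show "real (card {y. adjacent n x y \<and> parity_function S y = parity_function S x}) / real n
      = real (n - card S) / real n"
    using assms \<open>finite S\<close> by (simp add: card_agreeing_neighbours[OF x] card_Diff_subset)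
qed

section \<open>Signed parities of the same size are isomorphic\<close>

text \<open>
  Permuting coordinates and reflecting some of them preserves the set of differing coordinates
  up to relabelling.
\<close>
lemma signed_permutation_automorphism:
  assumes \<sigma>: "bij_betw \<sigma> {1..n} {1..n}" and s: "\<And>j. j \<in> {1..n} \<Longrightarrow> s j \<in> {-1, 1 :: int}"
  shows "hypercube_automorphism n (\<lambda>x. \<lambda>j\<in>{1..n}. s j * x (\<sigma> j))" (is "hypercube_automorphism n ?\<psi>")
proof -
  have \<sigma>_mem: "\<sigma> j \<in> {1..n}" if "j \<in> {1..n}" for j
    using \<sigma> that by (rule bij_betw_apply)
  have closed: "?\<psi> x \<in> hypercube n" if "x \<in> hypercube n" for x
    unfolding hypercube_def
  proof (rule restrict_PiE_iff[THEN iffD2], rule ballI)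
    fix j assume "j \<in> {1..n}"
    then show "s j * x (\<sigma> j) \<in> {-1, 1}"
      using s[of j] hypercube_coord[OF that \<sigma>_mem[of j]] by auto
  qed
  have differ: "?\<psi> x j \<noteq> ?\<psi> y j \<longleftrightarrow> x (\<sigma> j) \<noteq> y (\<sigma> j)" if "j \<in> {1..n}" for x y j
    using s[OF that] that by auto
  have "bij_betw \<sigma> {j \<in> {1..n}. ?\<psi> x j \<noteq> ?\<psi> y j} {i \<in> {1..n}. x i \<noteq> y i}" for x y
  proof (rule bij_betw_subset[OF \<sigma>])
    show "\<sigma> ` {j \<in> {1..n}. ?\<psi> x j \<noteq> ?\<psi> y j} = {i \<in> {1..n}. x i \<noteq> y i}"
    proof (intro equalityI subsetI)
      fix i assume i: "i \<in> {i \<in> {1..n}. x i \<noteq> y i}"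
      then obtain j where "j \<in> {1..n}" "i = \<sigma> j"
        using bij_betw_imp_surj_on[OF \<sigma>] by blast
      with i differ show "i \<in> \<sigma> ` {j \<in> {1..n}. ?\<psi> x j \<noteq> ?\<psi> y j}" by blast
    qed (use differ \<sigma>_mem in blast)
  qed auto
  then have same_card: "card {j \<in> {1..n}. ?\<psi> x j \<noteq> ?\<psi> y j} = card {i \<in> {1..n}. x i \<noteq> y i}" for x y
    by (rule bij_betw_same_card)
  have inj: "inj_on ?\<psi> (hypercube n)"
  proof (rule inj_onI)
    fix x y assume xy: "x \<in> hypercube n" "y \<in> hypercube n" and "?\<psi> x = ?\<psi> y"
    then have "card {i \<in> {1..n}. x i \<noteq> y i} = 0"
      using same_card[of x y] by simp
    then have "{i \<in> {1..n}. x i \<noteq> y i} = {}"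
      by (subst (asm) card_0_eq) auto
    then show "x = y"
      by (intro hypercube_eqI[OF xy]) blast
  qed
  have "?\<psi> ` hypercube n = hypercube n"
    by (rule endo_inj_surj[OF finite_hypercube _ inj]) (use closed in blast)
  then show ?thesis
    unfolding hypercube_automorphism_def adjacent_def
    using inj closed same_card by (simp add: bij_betw_def)
qed

lemma ex_bij_mapping_subset:
  assumes "finite A" "S \<subseteq> A" "T \<subseteq> A" "card S = card T"
  obtains \<sigma> where "bij_betw \<sigma> A A" "bij_betw \<sigma> S T"
proof -
  have fin: "finite S" "finite T" using assms finite_subset by blast+
  have "card (A - S) = card (A - T)"
    using assms fin by (simp add: card_Diff_subset)
  then obtain \<alpha> \<beta> where \<alpha>: "bij_betw \<alpha> S T" and \<beta>: "bij_betw \<beta> (A - S) (A - T)"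
    using fin assms finite_same_card_bij[of S T] finite_same_card_bij[of "A - S" "A - T"] by auto
  have "bij_betw (\<lambda>i. if i \<in> S then \<alpha> i else \<beta> i) (S \<union> (A - S)) (T \<union> (A - T))"
    by (rule bij_betw_disjoint_Un[OF \<alpha> \<beta>]) auto
  moreover have "S \<union> (A - S) = A" "T \<union> (A - T) = A" using assms by auto
  moreover have "bij_betw (\<lambda>i. if i \<in> S then \<alpha> i else \<beta> i) S T"
    using \<alpha> by (subst bij_betw_cong[of S _ \<alpha>]) auto
  ultimately show ?thesis using that by simp
qed

text \<open>
  A coordinate of \<open>S\<close> is needed to carry the sign: the constants \<open>1\<close> and \<open>-1\<close> are not isomorphic.
\<close>
lemma signed_parity_isomorphic:
  assumes "S \<subseteq> {1..n}" "T \<subseteq> {1..n}" "card S = card T" "S \<noteq> {}" "c \<in> {-1, 1}"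
    and f: "\<And>x. x \<in> hypercube n \<Longrightarrow> f x = c * parity_function S x"
  shows "isomorphic n f (parity_function T)"
proof -
  obtain \<sigma> where \<sigma>: "bij_betw \<sigma> {1..n} {1..n}" "bij_betw \<sigma> S T"
    using assms(1-3) by (rule ex_bij_mapping_subset[OF finite_atLeastAtMost])
  obtain k where k: "k \<in> S" using assms(4) by blast
  define s where "s j = (if j = k then c else 1)" for j :: nat
  define \<psi> where "\<psi> = (\<lambda>x. \<lambda>j\<in>{1..n}. s j * x (\<sigma> j))"
  have auto: "hypercube_automorphism n \<psi>"
    unfolding \<psi>_def
    by (rule signed_permutation_automorphism[OF \<sigma>(1)]) (use assms(5) in \<open>auto simp: s_def\<close>)
  have "f (\<psi> x) = parity_function T x" if x: "x \<in> hypercube n" for x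
  proof -
    have "\<psi> x \<in> hypercube n"
      using auto x unfolding hypercube_automorphism_def by (auto dest: bij_betw_apply)
    then have "f (\<psi> x) = c * (\<Prod>j\<in>S. \<psi> x j)"
      by (simp add: f parity_function_def)
    also have "(\<Prod>j\<in>S. \<psi> x j) = (\<Prod>j\<in>S. s j * x (\<sigma> j))"
      using assms(1) by (intro prod.cong) (auto simp: \<psi>_def)
    also have "\<dots> = (\<Prod>j\<in>S. s j) * (\<Prod>j\<in>S. x (\<sigma> j))"
      by (rule prod.distrib)
    also have "(\<Prod>j\<in>S. s j) = c"
      using k finite_subset[OF assms(1)] by (simp add: s_def prod.delta)
    also have "(\<Prod>j\<in>S. x (\<sigma> j)) = parity_function T x"
      unfolding parity_function_def by (rule prod.reindex_bij_betw[OF \<sigma>(2)])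
    finally show ?thesis using assms(5) by auto
  qed
  with auto show ?thesis unfolding isomorphic_def by blast
qed

section \<open>One exceptional neighbour\<close>

text \<open>
  Connectedness enters twice: the direction of the disagreement is the same at all vertices, and
  then \<open>f x * x i\<close> is constant because both factors change sign exactly along direction \<open>i\<close>.
\<close>
lemma one_disagreeing_neighbour_imp_signed_coordinate:
  assumes val: "f \<in> hypercube n \<rightarrow> {-1, 1 :: int}"
    and uniq: "\<And>x. x \<in> hypercube n \<Longrightarrow> card {i \<in> {1..n}. f (flip i x) \<noteq> f x} = 1"
  obtains i c where "i \<in> {1..n}" "c \<in> {-1, 1}" "\<And>x. x \<in> hypercube n \<Longrightarrow> f x = c * x i"
proof -
  define d where "d x = (THE i. {i \<in> {1..n}. f (flip i x) \<noteq> f x} = {i})" for x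
  have d: "{i \<in> {1..n}. f (flip i x) \<noteq> f x} = {d x}" if x: "x \<in> hypercube n" for x
  proof -
    obtain i where "{i \<in> {1..n}. f (flip i x) \<noteq> f x} = {i}"
      by (rule card_1_singletonE[OF uniq[OF x]])
    then show ?thesis by (simp add: d_def)
  qed
  have d_mem: "d x \<in> {1..n}" if "x \<in> hypercube n" for x
    using arg_cong[OF d[OF that], of "\<lambda>A. d x \<in> A"] by simp
  have differ: "f (flip i x) \<noteq> f x \<longleftrightarrow> i = d x" if "x \<in> hypercube n" "i \<in> {1..n}" for i x
    using arg_cong[OF d[OF that(1)], of "\<lambda>A. i \<in> A"] that(2) by simp
  have d_flip: "d (flip j x) = d x" if x: "x \<in> hypercube n" and j: "j \<in> {1..n}" for j x
  proof (cases "j = d x")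
    case True
    then have "f (flip j (flip j x)) \<noteq> f (flip j x)"
      using differ[OF x j] by simp
    with True show ?thesis
      using differ[OF flip_in_hypercube[OF x j] j] by simp
  next
    case False
    \<comment> \<open>The square argument: \<open>f\<close> agrees along both sides in direction \<open>j\<close>, so it disagrees along
      both sides in direction \<open>d x\<close>.\<close>
    let ?i = "d x"
    have i: "?i \<in> {1..n}" using d_mem[OF x] .
    have "d (flip ?i x) = ?i"
      using differ[OF flip_in_hypercube[OF x i] i] differ[OF x i] by simp
    then have "f (flip j (flip ?i x)) = f (flip ?i x)"
      using differ[OF flip_in_hypercube[OF x i] j] False by simp
    moreover have "f (flip j x) = f x"
      using differ[OF x j] False by simp
    ultimately have "f (flip ?i (flip j x)) \<noteq> f (flip j x)"
      using differ[OF x i] by (simp add: flip_commute)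
    then show ?thesis
      using differ[OF flip_in_hypercube[OF x j] i] by simp
  qed
  have d_const: "d x = d y" if "x \<in> hypercube n" "y \<in> hypercube n" for x y
    using d_flip that by (rule flip_invariant_imp_constant)
  obtain v where v: "v \<in> hypercube n" using hypercube_nonempty by blast
  define i where "i = d v"
  have i: "i \<in> {1..n}" using d_mem[OF v] by (simp add: i_def)
  have differ_i: "f (flip j x) \<noteq> f x \<longleftrightarrow> j = i" if "x \<in> hypercube n" "j \<in> {1..n}" for j x
    using differ[OF that] d_const[OF that(1) v] by (simp add: i_def)
  have flip_coord: "f (flip j x) * flip j x i = f x * x i" if x: "x \<in> hypercube n" and j: "j \<in> {1..n}" for j x
  proof (cases "j = i")
    case True
    have "f x \<in> {-1, 1}" "f (flip j x) \<in> {-1, 1}"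
      using val x flip_in_hypercube[OF x j] by blast+
    then have "f (flip j x) = - f x"
      using differ_i[OF x j] True by auto
    with True show ?thesis by (simp add: flip_def)
  next
    case False
    then show ?thesis using differ_i[OF x j] by (simp add: flip_def)
  qed
  have const: "f x * x i = f y * y i" if "x \<in> hypercube n" "y \<in> hypercube n" for x y
    using flip_coord that by (rule flip_invariant_imp_constant[where h = "\<lambda>x. f x * x i"])
  show ?thesis
  proof (rule that[OF i, of "f v * v i"])
    have "f v \<in> {-1, 1}" using val v by blast
    then show "f v * v i \<in> {-1, 1}"
      using hypercube_coord[OF v i] by auto
    fix x assume x: "x \<in> hypercube n"
    have "f x = f x * x i * x i"
      using hypercube_coord_square[OF x i] by (simp add: mult.assoc)
    then show "f x = f v * v i * x i"
      using const[OF x v] by simp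
  qed
qed

text \<open>
  Multiplication by the parity on all variables turns the one agreeing neighbour into the one
  disagreeing neighbour.
\<close>
lemma one_agreeing_neighbour_imp_signed_parity:
  assumes val: "f \<in> hypercube n \<rightarrow> {-1, 1 :: int}"
    and uniq: "\<And>x. x \<in> hypercube n \<Longrightarrow> card {i \<in> {1..n}. f (flip i x) = f x} = 1"
  obtains i c where "i \<in> {1..n}" "c \<in> {-1, 1}"
    "\<And>x. x \<in> hypercube n \<Longrightarrow> f x = c * parity_function ({1..n} - {i}) x"
proof -
  let ?P = "parity_function {1..n}"
  define g where "g x = f x * ?P x" for x
  have P: "?P x \<in> {-1, 1}" if "x \<in> hypercube n" for x
    by (rule parity_function_values[OF that]) simp
  have f: "f x \<in> {-1, 1}" if "x \<in> hypercube n" for x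
    using val that by blast
  have "g \<in> hypercube n \<rightarrow> {-1, 1}"
  proof
    fix x assume "x \<in> hypercube n"
    from P[OF this] f[OF this] show "g x \<in> {-1, 1}" by (auto simp: g_def)
  qed
  moreover have "card {i \<in> {1..n}. g (flip i x) \<noteq> g x} = 1" if x: "x \<in> hypercube n" for x
  proof -
    have "g (flip i x) \<noteq> g x \<longleftrightarrow> f (flip i x) = f x" if i: "i \<in> {1..n}" for i
      using P[OF x] f[OF x] f[OF flip_in_hypercube[OF x i]] i
      by (auto simp: g_def parity_function_flip)
    then have "{i \<in> {1..n}. g (flip i x) \<noteq> g x} = {i \<in> {1..n}. f (flip i x) = f x}"
      by blast
    with uniq[OF x] show ?thesis by simp
  qed
  ultimately obtain i c where i: "i \<in> {1..n}" and c: "c \<in> {-1, 1}"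
    and g: "\<And>x. x \<in> hypercube n \<Longrightarrow> g x = c * x i"
    using one_disagreeing_neighbour_imp_signed_coordinate by blast
  have "f x = c * parity_function ({1..n} - {i}) x" if x: "x \<in> hypercube n" for x
  proof -
    have "f x = g x * ?P x"
      using P[OF x] by (auto simp: g_def)
    also have "?P x = x i * parity_function ({1..n} - {i}) x"
      unfolding parity_function_def using i by (intro prod.remove) auto
    also have "g x * \<dots> = c * (x i * x i) * parity_function ({1..n} - {i}) x"
      by (simp add: g[OF x])
    finally show ?thesis by (simp add: hypercube_coord_square[OF x i])
  qed
  with i c show ?thesis by (rule that)
qed

section \<open>Uniqueness\<close>

lemma locally_stable_imp_card:
  assumes "locally_stable n (real k / real n) f" "n \<ge> 1" "x \<in> hypercube n"
  shows "card {i \<in> {1..n}. f (flip i x) = f x} = k"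
  using assms by (simp add: locally_stable_def card_agreeing_neighbours)

lemma unique_locally_stable_single_variable:
  assumes "n \<ge> 1"
  shows "unique_locally_stable n (real (n - 1) / real n) (parity_function {n})"
  unfolding unique_locally_stable_def
proof (intro conjI allI impI)
  show "locally_stable n (real (n - 1) / real n) (parity_function {n})"
    using locally_stable_parity[of "{n}" n] assms by simp
next
  fix f assume st: "locally_stable n (real (n - 1) / real n) f"
  have "card {i \<in> {1..n}. f (flip i x) \<noteq> f x} = 1" if x: "x \<in> hypercube n" for x
  proof -
    let ?A = "{i \<in> {1..n}. f (flip i x) = f x}"
    have "{i \<in> {1..n}. f (flip i x) \<noteq> f x} = {1..n} - ?A"
      by blast
    moreover have "card ({1..n} - ?A) = n - card ?A"
      by (subst card_Diff_subset) auto
    ultimately show ?thesis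
      using locally_stable_imp_card[OF st assms x] assms by simp
  qed
  moreover have "f \<in> hypercube n \<rightarrow> {-1, 1}" using st by (simp add: locally_stable_def)
  ultimately obtain i c where ic: "i \<in> {1..n}" "c \<in> {-1, 1}"
    and f: "\<And>x. x \<in> hypercube n \<Longrightarrow> f x = c * x i"
    using one_disagreeing_neighbour_imp_signed_coordinate by blast
  show "isomorphic n f (parity_function {n})"
    by (rule signed_parity_isomorphic[of "{i}" n "{n}" c])
      (use ic assms in \<open>auto simp: parity_function_def f\<close>)
qed

lemma unique_locally_stable_all_but_one_variable:
  assumes "n \<ge> 2"
  shows "unique_locally_stable n (real 1 / real n) (parity_function {2..n})"
  unfolding unique_locally_stable_def
proof (intro conjI allI impI)
  have "n - card {2..n} = 1" using assms by simp
  then show "locally_stable n (real 1 / real n) (parity_function {2..n})"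
    using locally_stable_parity[of "{2..n}" n] by simp
next
  fix f assume st: "locally_stable n (real 1 / real n) f"
  have "card {i \<in> {1..n}. f (flip i x) = f x} = 1" if "x \<in> hypercube n" for x
    using locally_stable_imp_card[OF st _ that] assms by simp
  moreover have "f \<in> hypercube n \<rightarrow> {-1, 1}" using st by (simp add: locally_stable_def)
  ultimately obtain i c where ic: "i \<in> {1..n}" "c \<in> {-1, 1}"
    and f: "\<And>x. x \<in> hypercube n \<Longrightarrow> f x = c * parity_function ({1..n} - {i}) x"
    using one_agreeing_neighbour_imp_signed_parity by blast
  have "card ({1..n} - {i}) = n - 1" using ic by simp
  moreover from this have "{1..n} - {i} \<noteq> {}"
    using assms by (metis card.empty diff_is_0_eq not_less_eq_eq numeral_2_eq_2 One_nat_def)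
  ultimately show "isomorphic n f (parity_function {2..n})"
    by (intro signed_parity_isomorphic[of "{1..n} - {i}" n "{2..n}" c])
      (use ic f in auto)
qed

theorem proposition4p2:
  fixes n :: nat and p :: real
  shows "(n \<ge> 1 \<and> p = (real n - 1) / real n \<longrightarrow>
            unique_locally_stable n p (parity_function {n})) \<and>
         (n \<ge> 2 \<and> p = 1 / real n \<longrightarrow>
            unique_locally_stable n p (parity_function {2..n}))"
  using unique_locally_stable_single_variable[of n]
    unique_locally_stable_all_but_one_variable[of n]
  by auto

end
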